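(* Let $X,Y$ be real Hilbert spaces and $a:X\times Y\to\mathbb{R}$ a bilinear form with $|a(x,y)|\le C_a\|x\|_X\|y\|_Y$ for all $x\in X$, $y\in Y$, whose continuous variational problem is well posed in the Babuška–Nečas sense. Let $X_0\subset X_1\subset\cdots\subset X$ and $Y_0\subset Y_1\subset\cdots\subset Y$ be nested finite-dimensional subspaces with $\dim X_\ell=\dim Y_\ell$ for all $\ell\ge0$, not all $X_\ell$ equal to $\{0\}$, and suppose that for some $\gamma>0$ $$\inf_{0\ne x_\ell\in X_\ell}\ \sup_{0\ne y_\ell\in Y_\ell}\frac{|a(x_\ell,y_\ell)|}{\|x_\ell\|_X\|y_\ell\|_Y}\ge\gamma\qquad(\ell\ge0).$$ Let $G_\ell:X\to X_\ell$ be the associated Galerkin projections, and set $$K=\frac{C_a}{\gamma},\qquad \vartheta_K=\sqrt{1-K^{-2}},\qquad \sigma_K=\log_2(1+\vartheta_K)<1.$$ For $u\in X$ and $\ell\ge0$ put $u_\ell:=G_\ell u$. Then, for every $u\in X$, $\ell\ge0$ and $N\ge1$, $$\sum_{k=\ell}^{\ell+N-1}\|u_{k+1}-u_k\|_X^2\le C_{\mathrm{qo}}(K)\,N^{\sigma_K}\,\|u-u_\ell\|_X^2,\qquad C_{\mathrm{qo}}(K)=4K^2(1+\vartheta_K).$$ Equivalently, the finite-window constants $\mathfrak{C}_{\mathcal G}(N)$ satisfy $$\mathfrak{C}_{\mathcal G}(N)\le 4K^2\bigl(1+\sqrt{1-K^{-2}}\bigr)N^{\log_2(1+\sqrt{1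-K^{-2}})}=o(N).$$
   Context: The Galerkin projection $G_\ell:X\to X_\ell$ is defined by $a(G_\ell x,y_\ell)=a(x,y_\ell)$ for all $y_\ell\in Y_\ell$; by $\dim X_\ell=\dim Y_\ell$ and the discrete inf-sup condition it exists and is unique. (The infimum over an empty set is $+\infty$.) Well-posedness in the Babuška–Nečas sense means that for every bounded linear functional $F$ on $Y$ there is a unique $x\in X$ with $a(x,y)=F(y)$ for all $y\in Y$, depending continuously on $F$. Write $\mathcal G=(G_\ell)_{\ell\ge0}$. For $N\ge1$ the finite-window constant is $$\mathfrak{C}_{\mathcal G}(N):=\sup_{\ell\ge0}\ \sup_{\substack{x\in X\\ (I-G_\ell)x\ne0}}\frac{\sum_{k=\ell}^{\ell+N-1}\|(G_{k+1}-G_k)x\|_X^2}{\|(I-G_\ell)x\|_X^2},$$ where suprema over empty sets are taken to be $0$. *)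

theory Defs
  imports "HOL-Analysis.Analysis" "HOL-Library.Landau_Symbols"
begin

definition well_posed_BN :: "('x::real_normed_vector \<Rightarrow> 'y::real_normed_vector \<Rightarrow> real) \<Rightarrow> bool" where
  "well_posed_BN a \<longleftrightarrow>
     (\<forall>F :: 'y \<Rightarrow>\<^sub>L real. \<exists>!x. \<forall>y. a x y = blinfun_apply F y) \<and>
     continuous_on UNIV (\<lambda>F :: 'y \<Rightarrow>\<^sub>L real. THE x. \<forall>y. a x y = blinfun_apply F y)"

definition fin_dim_subspace :: "'v::real_vector set \<Rightarrow> bool" where
  "fin_dim_subspace V \<longleftrightarrow> subspace V \<and> (\<exists>B. finite B \<and> V = span B)"

(* Taking values in ennreal makes the infimum over the empty set (the case V = {0}) equal to
   top, as required by the convention on empty infima. *)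
definition inf_sup_const ::
    "('x::real_normed_vector \<Rightarrow> 'y::real_normed_vector \<Rightarrow> real) \<Rightarrow> 'x set \<Rightarrow> 'y set \<Rightarrow> ennreal" where
  "inf_sup_const a V W =
     (INF x \<in> V - {0}. SUP y \<in> W - {0}. ennreal (\<bar>a x y\<bar> / (norm x * norm y)))"

(* Equal dimensions together with a positive inf-sup constant make this description proper:
   there is exactly one such z. Without them the value may be unspecified. *)
definition galerkin ::
    "('x \<Rightarrow> 'y \<Rightarrow> real) \<Rightarrow> (nat \<Rightarrow> 'x set) \<Rightarrow> (nat \<Rightarrow> 'y set) \<Rightarrow> nat \<Rightarrow> 'x \<Rightarrow> 'x" where
  "galerkin a X Y l x = (THE z. z \<in> X l \<and> (\<forall>y\<in>Y l. a z y = a x y))"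

(* In ennreal the supremum over the empty set is 0 and a possibly unbounded supremum is top. *)
definition finite_window_const :: "(nat \<Rightarrow> 'x::real_normed_vector \<Rightarrow> 'x) \<Rightarrow> nat \<Rightarrow> ennreal" where
  "finite_window_const G N =
     (SUP l. SUP x \<in> {x. x - G l x \<noteq> 0}.
        ennreal ((\<Sum>k=l..<l+N. (norm (G (Suc k) x - G k x))\<^sup>2) / (norm (x - G l x))\<^sup>2))"

definition theta_K :: "real \<Rightarrow> real" where
  "theta_K K = sqrt (1 - K powi (-2))"

definition sigma_K :: "real \<Rightarrow> real" where
  "sigma_K K = log 2 (1 + theta_K K)"

definition C_qo :: "real \<Rightarrow> real" where
  "C_qo K = 4 * K\<^sup>2 * (1 + theta_K K)"

end

theory Submission
  imports Defs
begin

text \<open>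
  The Galerkin projections form a nested family: \<open>G\<^sub>j G\<^sub>k = G\<close> with index \<open>min j k\<close>, and the
  inf-sup condition bounds each of them by \<open>K\<close>. The increments
  \<open>D\<^sub>k = G\<close>(\<open>k + 1\<close>) \<open>- G\<^sub>k\<close> are therefore bounded by \<open>2 K\<close>, and only the interaction of different
  increments is at stake.

  In a Hilbert space a projection of norm at most \<open>K\<close> has range and kernel at an angle with cosine
  at most \<open>\<theta> = sqrt (1 - 1 / K\<^sup>2)\<close>. Hence a vector of the range and one of the kernel satisfy
  \<open>\<parallel>u + v\<parallel>\<^sup>2 \<le> (1 + \<theta>) (\<parallel>u\<parallel>\<^sup>2 + \<parallel>v\<parallel>\<^sup>2)\<close>. Cutting a window of increments in the middle puts its first
  half in the range and its second half in the kernel of one projection of the family, so each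
  doubling of the window costs only the factor \<open>1 + \<theta>\<close> (\<open>norm_sum_increments_le\<close>). This is where
  the exponent \<open>log 2 (1 + \<theta>)\<close> comes from; it is below \<open>1\<close> because \<open>\<theta> < 1\<close>.

  That argument bounds the norm of a sum by the norms of its increments, while quasi-orthogonality
  asks for the converse. Splitting directly in the converse direction would cost \<open>1 / (1 - \<theta>)\<close> per
  doubling, which is no better than linear growth in \<open>N\<close> once \<open>\<theta> \<ge> 1 / 2\<close>. Duality avoids this: the adjoint projections
  are nested and bounded by \<open>K\<close> as well, and the square sum \<open>S\<close> of the \<open>\<parallel>D\<^sub>k x\<parallel>\<close> is the inner product
  of \<open>x\<close> with the sum of the adjoint increments of the vectors \<open>D\<^sub>k x\<close>. The dyadic bound for the
  adjoints and the Cauchy-Schwarz inequality give \<open>S\<^sup>2 \<le> \<parallel>x\<parallel>\<^sup>2 (1 + \<theta>) N powr \<sigma> (2 K)\<^sup>2 S\<close>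
  (\<open>sum_norm_increments_le\<close>). The theorem is the case \<open>x = u - G\<^sub>l u\<close>. A window sees finitely many
  projections of finite rank, so the adjoints are needed on a finite-dimensional space only.
\<close>

section \<open>The angle between range and kernel of a projection\<close>

lemma theta_K_bounds:
  assumes "K \<ge> 1"
  shows "(theta_K K)\<^sup>2 = 1 - 1 / K\<^sup>2" "0 \<le> theta_K K" "theta_K K < 1"
proof -
  have "K powi (-2) = 1 / K\<^sup>2"
    using power_int_minus_divide[of K 2] by simp
  moreover have "1 / K\<^sup>2 \<le> 1" "1 / K\<^sup>2 > 0"
    using assms by (auto simp: divide_simps)
  ultimately show "(theta_K K)\<^sup>2 = 1 - 1 / K\<^sup>2" "0 \<le> theta_K K" "theta_K K < 1"
    by (auto simp: theta_K_def)
qed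

lemma sigma_K_bounds:
  assumes "K \<ge> 1"
  shows "0 \<le> sigma_K K" "sigma_K K < 1"
  using theta_K_bounds[OF assms] by (auto simp: sigma_K_def)

text \<open>
  Among all \<open>u - t v\<close> the shortest is orthogonal to \<open>v\<close> and has squared norm
  \<open>\<parallel>u\<parallel>\<^sup>2 - (u \<bullet> v)\<^sup>2 / \<parallel>v\<parallel>\<^sup>2\<close>. The projection maps it to \<open>u\<close>, so it cannot be shorter than \<open>\<parallel>u\<parallel> / K\<close>.
\<close>

lemma inner_range_kernel_le:
  fixes P :: "'x::real_inner \<Rightarrow> 'x"
  assumes P: "linear P" "\<And>x. norm (P x) \<le> K * norm x" and K: "K \<ge> 1"
    and u: "P u = u" and v: "P v = 0"
  shows "\<bar>u \<bullet> v\<bar> \<le> theta_K K * norm u * norm v"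
proof (cases "v = 0")
  case False
  define t where "t = (u \<bullet> v) / (v \<bullet> v)"
  have vv: "v \<bullet> v > 0" using False by simp
  have "P (u - t *\<^sub>R v) = u"
    using u v by (simp add: linear_diff[OF P(1)] linear_scale[OF P(1)])
  then have "norm u \<le> K * norm (u - t *\<^sub>R v)"
    using P(2) by metis
  then have "(norm u)\<^sup>2 \<le> K\<^sup>2 * (norm (u - t *\<^sub>R v))\<^sup>2"
    by (metis norm_ge_zero power_mono power_mult_distrib)
  moreover have "(norm (u - t *\<^sub>R v))\<^sup>2 = u \<bullet> u - (u \<bullet> v)\<^sup>2 / (v \<bullet> v)"
    using vv unfolding power2_norm_eq_inner t_def
    by (simp add: inner_diff_left inner_diff_right inner_commute power2_eq_square field_simps)
  ultimately have "u \<bullet> u \<le> K\<^sup>2 * (u \<bullet> u - (u \<bullet> v)\<^sup>2 / (v \<bullet> v))"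
    by (simp add: power2_norm_eq_inner)
  then have "(u \<bullet> u) / K\<^sup>2 \<le> u \<bullet> u - (u \<bullet> v)\<^sup>2 / (v \<bullet> v)"
    using K by (simp add: pos_divide_le_eq mult.commute)
  then have "(u \<bullet> v)\<^sup>2 / (v \<bullet> v) \<le> (1 - 1 / K\<^sup>2) * (u \<bullet> u)"
    by (simp add: algebra_simps)
  then have "(u \<bullet> v)\<^sup>2 \<le> (1 - 1 / K\<^sup>2) * (u \<bullet> u) * (v \<bullet> v)"
    using vv by (simp add: pos_divide_le_eq)
  also have "\<dots> = (theta_K K * norm u * norm v)\<^sup>2"
    using theta_K_bounds(1)[OF K] by (simp add: power_mult_distrib power2_norm_eq_inner)
  finally show ?thesis
    using theta_K_bounds(2)[OF K] by (simp add: abs_le_square_iff[symmetric] abs_mult)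
qed simp

lemma norm_add_range_kernel_le:
  fixes P :: "'x::real_inner \<Rightarrow> 'x"
  assumes "linear P" "\<And>x. norm (P x) \<le> K * norm x" "K \<ge> 1" "P u = u" "P v = 0"
  shows "(norm (u + v))\<^sup>2 \<le> (1 + theta_K K) * ((norm u)\<^sup>2 + (norm v)\<^sup>2)"
proof -
  have "2 * (norm u * norm v) \<le> (norm u)\<^sup>2 + (norm v)\<^sup>2"
    using sum_squares_bound[of "norm u" "norm v"] by simp
  from mult_left_mono[OF this theta_K_bounds(2)[OF assms(3)]]
  have "2 * (theta_K K * norm u * norm v) \<le> theta_K K * ((norm u)\<^sup>2 + (norm v)\<^sup>2)"
    by (simp add: algebra_simps)
  moreover have "u \<bullet> v \<le> theta_K K * norm u * norm v"
    using inner_range_kernel_le[OF assms] by simp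
  moreover have "(norm (u + v))\<^sup>2 = (norm u)\<^sup>2 + (norm v)\<^sup>2 + 2 * (u \<bullet> v)"
    by (simp add: power2_norm_eq_inner inner_add_left inner_add_right inner_commute)
  ultimately show ?thesis by (simp add: algebra_simps)
qed

section \<open>Sums of increments of nested projections\<close>

text \<open>
  The vectors \<open>d\<^sub>k\<close> are increments in the sense that they lie in the range of the projection
  with index \<open>k + 1\<close> and in the kernel of \<open>Q\<^sub>k\<close>. By nestedness every later projection fixes them and
  every earlier one annihilates them, which is what makes the bisection work.
\<close>

lemma norm_sum_increments_le:
  fixes Q :: "nat \<Rightarrow> 'x::real_inner \<Rightarrow> 'x"
  assumes lin: "\<And>k. linear (Q k)"
    and nested: "\<And>j k x. Q j (Q k x) = Q (min j k) x"
    and bound: "\<And>k x. norm (Q k x) \<le> K * norm x" and K: "K \<ge> 1"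
    and ran: "\<And>k. Q (Suc k) (d k) = d k" and ker: "\<And>k. Q k (d k) = 0"
    and "N \<le> 2 ^ n"
  shows "(norm (\<Sum>k=l..<l+N. d k))\<^sup>2 \<le> (1 + theta_K K) ^ n * (\<Sum>k=l..<l+N. (norm (d k))\<^sup>2)"
  using \<open>N \<le> 2 ^ n\<close>
proof (induction n arbitrary: l N)
  case 0
  then have "N = 0 \<or> N = 1" by auto
  then show ?case by auto
next
  case (Suc n)
  define M where "M = min N (2 ^ n)"
  define m where "m = l + M"
  have MN: "M \<le> N" "M \<le> 2 ^ n" "N - M \<le> 2 ^ n" "l \<le> m" "m \<le> l + N" "m + (N - M) = l + N"
    using Suc.prems by (auto simp: M_def m_def)
  let ?u = "\<Sum>k=l..<m. d k" and ?v = "\<Sum>k=m..<l+N. d k"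
  let ?S = "\<lambda>A. \<Sum>k\<in>A. (norm (d k))\<^sup>2"
  have "Q m (d k) = d k" if "k < m" for k
    using nested[of m "Suc k" "d k"] that by (simp only: ran min_absorb2 Suc_leI)
  then have Qu: "Q m ?u = ?u"
    unfolding linear_sum[OF lin] by (intro sum.cong) auto
  have "Q m (d k) = 0" if "m \<le> k" for k
    using nested[of m k "d k"] that by (simp only: ker min_absorb1 linear_0[OF lin])
  then have Qv: "Q m ?v = 0"
    unfolding linear_sum[OF lin] by (intro sum.neutral) auto
  have t: "0 \<le> 1 + theta_K K" using theta_K_bounds(2)[OF K] by simp
  have "(norm ?u)\<^sup>2 \<le> (1 + theta_K K) ^ n * ?S {l..<m}"
    using Suc.IH[of M l] MN by (simp add: m_def)
  moreover have "(norm ?v)\<^sup>2 \<le> (1 + theta_K K) ^ n * ?S {m..<l+N}"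
    using Suc.IH[of "N - M" m] MN by simp
  ultimately have *: "(norm ?u)\<^sup>2 + (norm ?v)\<^sup>2
      \<le> (1 + theta_K K) ^ n * (?S {l..<m} + ?S {m..<l+N})"
    by (simp add: distrib_left)
  have "(norm (\<Sum>k=l..<l+N. d k))\<^sup>2 = (norm (?u + ?v))\<^sup>2"
    by (simp only: sum.atLeastLessThan_concat[OF MN(4,5)])
  also have "\<dots> \<le> (1 + theta_K K) * ((norm ?u)\<^sup>2 + (norm ?v)\<^sup>2)"
    by (rule norm_add_range_kernel_le[OF lin bound K Qu Qv])
  also have "\<dots> \<le> (1 + theta_K K) * ((1 + theta_K K) ^ n * (?S {l..<m} + ?S {m..<l+N}))"
    by (rule mult_left_mono[OF * t])
  also have "\<dots> = (1 + theta_K K) ^ Suc n * ?S {l..<l+N}"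
    by (simp only: sum.atLeastLessThan_concat[OF MN(4,5)] power_Suc mult.assoc)
  finally show ?case .
qed

text \<open>
  Rounding the window length up to a power of two at most doubles it; this is the origin of the
  extra factor \<open>1 + \<theta>\<close> in the constant.
\<close>

lemma ex_dyadic_bound:
  assumes "N \<ge> 1" and K: "K \<ge> 1"
  obtains n where "N \<le> 2 ^ n" "(1 + theta_K K) ^ n \<le> (1 + theta_K K) * real N powr sigma_K K"
proof -
  define n where "n = (LEAST n. N \<le> 2 ^ n)"
  have "\<exists>n. N \<le> 2 ^ n" by (rule exI[of _ N]) (simp add: less_imp_le)
  then have n: "N \<le> 2 ^ n" unfolding n_def by (rule LeastI_ex)
  have "2 ^ n \<le> 2 * N"
  proof (cases n)
    case (Suc m)
    then have "\<not> N \<le> 2 ^ m" unfolding n_def by (metis lessI not_less_Least)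
    then show ?thesis using Suc by simp
  qed (use assms in simp)
  then have n2: "(2::real) ^ n \<le> 2 * real N"
    by (metis of_nat_le_iff of_nat_mult of_nat_numeral of_nat_power)
  have th: "1 + theta_K K > 0" using theta_K_bounds(2)[OF K] by simp
  then have *: "2 powr sigma_K K = 1 + theta_K K" by (simp add: sigma_K_def)
  have "(1 + theta_K K) ^ n = (2 powr sigma_K K) powr real n"
    using * th by (simp add: powr_realpow)
  also have "\<dots> = (2 ^ n) powr sigma_K K"
    by (simp add: powr_powr powr_realpow[symmetric] mult.commute)
  also have "\<dots> \<le> (2 * real N) powr sigma_K K"
    using n2 sigma_K_bounds[OF K] by (intro powr_mono2) auto
  also have "\<dots> = (1 + theta_K K) * real N powr sigma_K K"
    by (simp add: powr_mult *)
  finally show thesis using n that by blast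
qed

section \<open>Duality\<close>

text \<open>
  On the span of a finite set the adjoint can be written down in an orthogonal basis. The vectors
  produced by the orthogonalisation may vanish, in which case the division by zero yields a zero
  summand, as it should.
\<close>

lemma ex_adjoint_on_span:
  fixes P :: "'x::real_inner \<Rightarrow> 'x"
  assumes "finite B" and P: "linear P"
  shows "\<exists>Q. linear Q \<and> range Q \<subseteq> span B \<and> (\<forall>x\<in>span B. \<forall>y. P x \<bullet> y = x \<bullet> Q y)"
proof -
  obtain C where C: "finite C" "span C = span B" "pairwise orthogonal C"
    using basis_orthogonal[OF \<open>finite B\<close>] by blast
  define Q where "Q y = (\<Sum>b\<in>C. ((P b \<bullet> y) / (b \<bullet> b)) *\<^sub>R b)" for y
  have "linear Q"
    by (rule linearI) (simp_all add: Q_def inner_add_right add_divide_distrib scaleR_add_left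
        sum.distrib scaleR_sum_right)
  moreover have "range Q \<subseteq> span B"
    unfolding C(2)[symmetric] by (auto simp: Q_def intro!: span_sum span_scale intro: span_base)
  moreover have "P x \<bullet> y = x \<bullet> Q y" if "x \<in> span B" for x y
    using that unfolding C(2)[symmetric]
  proof (induction rule: span_induct_alt)
    case base
    show ?case by (simp add: linear_0[OF P])
  next
    case (step r c z)
    have "c \<bullet> Q y = (\<Sum>b\<in>C. if b = c then ((P b \<bullet> y) / (b \<bullet> b)) * (c \<bullet> b) else 0)"
      unfolding Q_def inner_sum_right using C(3) step(1)
      by (intro sum.cong) (auto simp: pairwise_def orthogonal_def)
    also have "\<dots> = P c \<bullet> y"
      using C(1) step(1) by (cases "c = 0") (simp_all add: linear_0[OF P])
    finally show ?case
      using step(2) by (simp add: linear_add[OF P] linear_scale[OF P] inner_add_left)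
  qed
  ultimately show ?thesis by blast
qed

lemma sum_norm_increments_le:
  fixes P :: "nat \<Rightarrow> 'x::real_inner \<Rightarrow> 'x"
  assumes lin: "\<And>k. linear (P k)"
    and nested: "\<And>j k x. P j (P k x) = P (min j k) x"
    and bound: "\<And>k x. norm (P k x) \<le> K * norm x" and K: "K \<ge> 1"
    and B: "finite B" and inv: "\<And>k z. z \<in> span B \<Longrightarrow> P k z \<in> span B"
    and x: "x \<in> span B" and N: "N \<ge> 1"
  shows "(\<Sum>k=l..<l+N. (norm (P (Suc k) x - P k x))\<^sup>2) \<le> C_qo K * real N powr sigma_K K * (norm x)\<^sup>2"
proof -
  have "\<forall>k. \<exists>Q. linear Q \<and> range Q \<subseteq> span B \<and> (\<forall>x\<in>span B. \<forall>y. P k x \<bullet> y = x \<bullet> Q y)"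
    using ex_adjoint_on_span[OF B lin] by blast
  then obtain Q where Qlin: "\<And>k. linear (Q k)" and Qran: "\<And>k y. Q k y \<in> span B"
    and adj: "\<And>k x y. x \<in> span B \<Longrightarrow> P k x \<bullet> y = x \<bullet> Q k y"
    unfolding choice_iff by blast
  have Qnested: "Q j (Q k y) = Q (min j k) y" for j k y
  proof -
    let ?d = "Q j (Q k y) - Q (min j k) y"
    have d: "?d \<in> span B" by (intro span_diff Qran)
    have "?d \<bullet> Q j (Q k y) = ?d \<bullet> Q (min j k) y"
      using d by (simp add: adj[symmetric] inv nested min.commute)
    then have "?d \<bullet> ?d = 0" by (simp add: inner_diff_right)
    then show ?thesis by simp
  qed
  have Qbound: "norm (Q k y) \<le> K * norm y" for k y
  proof -
    have "(norm (Q k y))\<^sup>2 = P k (Q k y) \<bullet> y"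
      by (simp add: power2_norm_eq_inner adj Qran)
    also have "\<dots> \<le> norm (P k (Q k y)) * norm y" by (rule norm_cauchy_schwarz)
    also have "\<dots> \<le> K * norm (Q k y) * norm y" by (intro mult_right_mono bound) simp
    finally have *: "norm (Q k y) * norm (Q k y) \<le> norm (Q k y) * (K * norm y)"
      by (simp add: power2_eq_square mult_ac)
    show ?thesis
    proof (cases "Q k y = 0")
      case True
      then show ?thesis using K by simp
    next
      case False
      then show ?thesis using * by simp
    qed
  qed
  define D where "D k = P (Suc k) x - P k x" for k
  define d where "d k = Q (Suc k) (D k) - Q k (D k)" for k
  define S where "S = (\<Sum>k=l..<l+N. (norm (D k))\<^sup>2)"
  define w where "w = (\<Sum>k=l..<l+N. d k)"
  define c where "c = (1 + theta_K K) * real N powr sigma_K K"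
  have S0: "S \<ge> 0" unfolding S_def by (intro sum_nonneg) simp
  have c0: "c \<ge> 0" using theta_K_bounds(2)[OF K] by (simp add: c_def)
  have "S = (\<Sum>k=l..<l+N. x \<bullet> d k)"
    unfolding S_def
    by (intro sum.cong refl)
       (simp add: D_def d_def power2_norm_eq_inner inner_diff_right inner_diff_left
          adj[OF x, symmetric])
  then have "S = x \<bullet> w" by (simp add: w_def inner_sum_right)
  then have "S \<le> norm x * norm w" using norm_cauchy_schwarz[of x w] by simp
  then have S2: "S\<^sup>2 \<le> (norm x)\<^sup>2 * (norm w)\<^sup>2"
    using S0 by (metis power_mono power_mult_distrib)
  obtain n where n: "N \<le> 2 ^ n" "(1 + theta_K K) ^ n \<le> c"
    using ex_dyadic_bound[OF N K] unfolding c_def by blast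
  have d: "Q (Suc k) (d k) = d k" "Q k (d k) = 0" for k
    by (simp_all add: d_def linear_diff[OF Qlin] Qnested min_def)
  have "norm (d k) \<le> 2 * K * norm (D k)" for k
    using norm_triangle_ineq4[of "Q (Suc k) (D k)" "Q k (D k)"] Qbound[of "Suc k" "D k"]
      Qbound[of k "D k"] by (simp add: d_def)
  then have "(norm (d k))\<^sup>2 \<le> 4 * K\<^sup>2 * (norm (D k))\<^sup>2" for k
    using power_mono[of "norm (d k)" "2 * K * norm (D k)" 2] by (simp add: power_mult_distrib)
  then have dS: "(\<Sum>k=l..<l+N. (norm (d k))\<^sup>2) \<le> 4 * K\<^sup>2 * S"
    unfolding S_def sum_distrib_left by (intro sum_mono)
  have "(norm w)\<^sup>2 \<le> (1 + theta_K K) ^ n * (\<Sum>k=l..<l+N. (norm (d k))\<^sup>2)"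
    unfolding w_def by (rule norm_sum_increments_le[OF Qlin Qnested Qbound K d n(1)])
  also have "\<dots> \<le> c * (4 * K\<^sup>2 * S)"
    by (intro mult_mono n(2) dS c0 sum_nonneg) auto
  finally have "(norm x)\<^sup>2 * (norm w)\<^sup>2 \<le> (norm x)\<^sup>2 * (c * (4 * K\<^sup>2 * S))"
    by (rule mult_left_mono) simp
  with S2 have "S * S \<le> S * (C_qo K * real N powr sigma_K K * (norm x)\<^sup>2)"
    by (simp add: power2_eq_square C_qo_def c_def algebra_simps)
  then have "S \<le> C_qo K * real N powr sigma_K K * (norm x)\<^sup>2"
  proof (cases "S = 0")
    case True
    then show ?thesis using theta_K_bounds(2)[OF K] by (simp add: C_qo_def)
  qed (use S0 in simp)
  then show ?thesis by (simp add: S_def D_def)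
qed

section \<open>Galerkin projections\<close>

lemma inf_sup_norm_le:
  assumes infsup: "inf_sup_const a V W \<ge> ennreal \<gamma>" and \<gamma>: "\<gamma> > 0"
    and z: "z \<in> V" "z \<noteq> 0" and le: "\<And>y. y \<in> W \<Longrightarrow> \<bar>a z y\<bar> \<le> C * norm y"
  shows "\<gamma> * norm z \<le> C"
proof -
  have "ennreal \<gamma> \<le> (SUP y \<in> W - {0}. ennreal (\<bar>a z y\<bar> / (norm z * norm y)))"
    using infsup z unfolding inf_sup_const_def by (auto simp: le_INF_iff)
  also have "\<dots> \<le> ennreal (C / norm z)"
  proof (rule SUP_least)
    fix y assume y: "y \<in> W - {0}"
    then have "\<bar>a z y\<bar> / (norm z * norm y) \<le> C / norm z"
      using le[of y] z(2) by (simp add: field_simps)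
    then show "ennreal (\<bar>a z y\<bar> / (norm z * norm y)) \<le> ennreal (C / norm z)"
      by (rule ennreal_leI)
  qed
  finally have "\<gamma> \<le> C / norm z" using \<gamma> by (auto simp: ennreal_le_iff2)
  then show ?thesis using z(2) by (simp add: field_simps)
qed

text \<open>
  For a basis \<open>C\<close> of \<open>W\<close>, the coordinates of \<open>T z\<close> are the values of \<open>a z\<close> on \<open>C\<close>. So \<open>T\<close> maps \<open>V\<close>
  into \<open>W\<close>, injectively by nondegeneracy, and hence onto by equality of dimensions. A preimage of
  \<open>T x\<close> in \<open>V\<close> is the solution sought.
\<close>

lemma ex_galerkin_solution:
  fixes a :: "'x::real_vector \<Rightarrow> 'y::real_vector \<Rightarrow> real"
  assumes bil: "bilinear a" and V: "fin_dim_subspace V" and W: "fin_dim_subspace W"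
    and dim: "dim V = dim W"
    and nondeg: "\<And>z. z \<in> V \<Longrightarrow> (\<And>y. y \<in> W \<Longrightarrow> a z y = 0) \<Longrightarrow> z = 0"
  shows "\<exists>z\<in>V. \<forall>y\<in>W. a z y = a x y"
proof -
  have subV: "subspace V" and subW: "subspace W"
    using V W by (auto simp: fin_dim_subspace_def)
  obtain B where B: "B \<subseteq> V" "independent B" "V \<subseteq> span B" "card B = dim V"
    using basis_exists by blast
  obtain C where C: "C \<subseteq> W" "independent C" "W \<subseteq> span C" "card C = dim W"
    using basis_exists by blast
  have sB: "span B = V" using B subV by (simp add: span_minimal subset_antisym)
  have sC: "span C = W" using C subW by (simp add: span_minimal subset_antisym)
  have fB: "finite B"
    using V B independent_span_bound unfolding fin_dim_subspace_def by blast
  have fC: "finite C"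
    using W C independent_span_bound unfolding fin_dim_subspace_def by blast
  define T where "T z = (\<Sum>c\<in>C. a z c *\<^sub>R c)" for z
  have linT: "linear T"
    by (rule linearI) (simp_all add: T_def bilinear_ladd[OF bil] bilinear_lmul[OF bil]
        scaleR_add_left sum.distrib scaleR_sum_right)
  have Tranges: "T z \<in> W" for z
    unfolding sC[symmetric] T_def by (intro span_sum span_scale) (rule span_base)
  have T0: "a z y = 0" if "T z = 0" "y \<in> W" for z y
  proof -
    have c0: "a z c = 0" if "c \<in> C" for c
      using independentD[OF C(2) fC subset_refl _ that, of "a z"] \<open>T z = 0\<close> by (simp add: T_def)
    have "y \<in> span C" using that sC by simp
    then show ?thesis
      by (induction rule: span_induct_alt)
         (simp_all add: bilinear_rzero[OF bil] bilinear_radd[OF bil] bilinear_rmul[OF bil] c0)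
  qed
  have "inj_on T (span B)"
  proof (rule inj_onI)
    fix p q assume pq: "p \<in> span B" "q \<in> span B" "T p = T q"
    then have "T (p - q) = 0" by (simp add: linear_diff[OF linT])
    moreover have "p - q \<in> V" using pq(1,2) unfolding sB[symmetric] by (rule span_diff)
    ultimately have "p - q = 0" using nondeg T0 by blast
    then show "p = q" by simp
  qed
  then have indT: "independent (T ` B)" and cardT: "card (T ` B) = card C"
    using linear_independent_injective_image[OF linT B(2)] B(4) C(4) dim
    by (simp_all add: card_image[OF inj_on_subset[OF _ span_superset]])
  have "C \<subseteq> span (T ` B)"
  proof
    fix c assume c: "c \<in> C"
    show "c \<in> span (T ` B)"
    proof (rule ccontr)
      assume nc: "c \<notin> span (T ` B)"
      then have "independent (insert c (T ` B))" using indT by (simp add: independent_insert)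
      moreover have "insert c (T ` B) \<subseteq> span C"
        using c Tranges by (auto simp: sC intro: subsetD[OF C(1)])
      ultimately have "card (insert c (T ` B)) \<le> card C"
        by (intro conjunct2[OF independent_span_bound[OF fC]])
      moreover have "c \<notin> T ` B" using nc by (metis span_base)
      ultimately show False using fB cardT by simp
    qed
  qed
  then have "W \<subseteq> span (T ` B)"
    using span_minimal[OF _ subspace_span] by (simp add: sC[symmetric])
  also have "\<dots> = T ` V" by (simp add: linear_span_image[OF linT] sB)
  finally have "T x \<in> T ` V" using Tranges[of x] by (rule subsetD)
  then obtain z where z: "z \<in> V" "T z = T x" by (metis imageE)
  have "a (z - x) y = 0" if "y \<in> W" for y
    using T0[OF _ that] z(2) by (simp add: linear_diff[OF linT])
  then show ?thesis using z(1) by (auto simp: bilinear_lsub[OF bil])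
qed

text \<open>
  Every algebraic property of the Galerkin projections follows from the unique solvability on
  \<open>X\<^sub>l\<close>; the norm bound is the inf-sup condition applied to the solution.
\<close>

lemma galerkin_properties:
  fixes a :: "'x::real_normed_vector \<Rightarrow> 'y::real_normed_vector \<Rightarrow> real"
    and X :: "nat \<Rightarrow> 'x set" and Y :: "nat \<Rightarrow> 'y set"
  assumes bil: "bilinear a" and cont: "\<And>x y. \<bar>a x y\<bar> \<le> C_a * norm x * norm y"
    and X: "\<And>l. fin_dim_subspace (X l)" and Y: "\<And>l. fin_dim_subspace (Y l)"
    and Xmono: "\<And>l. X l \<subseteq> X (Suc l)" and Ymono: "\<And>l. Y l \<subseteq> Y (Suc l)"
    and dim: "\<And>l. dim (X l) = dim (Y l)" and nontriv: "\<not> (\<forall>l. X l = {0})"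
    and \<gamma>: "\<gamma> > 0" and infsup: "\<And>l. inf_sup_const a (X l) (Y l) \<ge> ennreal \<gamma>"
  shows "galerkin a X Y l x \<in> X l"
    and "linear (galerkin a X Y l)"
    and "galerkin a X Y j (galerkin a X Y k x) = galerkin a X Y (min j k) x"
    and "C_a / \<gamma> \<ge> 1"
    and "norm (galerkin a X Y l x) \<le> C_a / \<gamma> * norm x"
proof -
  let ?G = "galerkin a X Y"
  have subX: "subspace (X l)" for l using X by (auto simp: fin_dim_subspace_def)
  have nondeg: "z = 0" if "z \<in> X l" "\<And>y. y \<in> Y l \<Longrightarrow> a z y = 0" for z l
  proof (rule ccontr)
    assume "z \<noteq> 0"
    then have "\<gamma> * norm z \<le> 0"
      using that by (intro inf_sup_norm_le[OF infsup \<gamma>]) auto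
    then show False using \<gamma> \<open>z \<noteq> 0\<close> by (simp add: mult_le_0_iff)
  qed
  have uniq: "z = w" if "z \<in> X l" "w \<in> X l" "\<And>y. y \<in> Y l \<Longrightarrow> a z y = a w y" for z w l
    using nondeg[of "z - w" l] that by (simp add: subspace_diff[OF subX] bilinear_lsub[OF bil])
  have ex1: "\<exists>!z. z \<in> X l \<and> (\<forall>y\<in>Y l. a z y = a x y)" for l x
  proof (rule ex_ex1I)
    show "\<exists>z. z \<in> X l \<and> (\<forall>y\<in>Y l. a z y = a x y)"
      using ex_galerkin_solution[OF bil X Y dim nondeg[of _ l]] by blast
  qed (auto intro: uniq)
  have G: "?G l x \<in> X l" "y \<in> Y l \<Longrightarrow> a (?G l x) y = a x y" for l x y
    using theI'[OF ex1[of l x]] unfolding galerkin_def by auto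
  have GI: "?G l x = z" if "z \<in> X l" "\<And>y. y \<in> Y l \<Longrightarrow> a z y = a x y" for l x z
    using G that by (intro uniq[where l = l]) auto
  show "?G l x \<in> X l" by (rule G)
  show "linear (?G l)"
  proof (rule linearI)
    show "?G l (p + q) = ?G l p + ?G l q" for p q
      by (rule GI) (simp_all add: G subspace_add[OF subX] bilinear_ladd[OF bil])
    show "?G l (r *\<^sub>R p) = r *\<^sub>R ?G l p" for r p
      by (rule GI) (simp_all add: G subspace_scale[OF subX] bilinear_lmul[OF bil])
  qed
  show "?G j (?G k x) = ?G (min j k) x"
  proof (cases "j \<le> k")
    case True
    then have "Y j \<subseteq> Y k" by (rule lift_Suc_mono_le[of Y, OF Ymono])
    then show ?thesis using True by (intro GI) (auto simp: min_def G)
  next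
    case False
    then have "X k \<subseteq> X j" by (intro lift_Suc_mono_le[of X, OF Xmono]) simp
    then show ?thesis using False G(1) by (intro GI) (auto simp: min_def)
  qed
  have bound: "\<gamma> * norm (?G l x) \<le> C_a * norm x" if "?G l x \<noteq> 0" for l x
    using cont by (intro inf_sup_norm_le[OF infsup \<gamma> G(1) that]) (auto simp: G)
  \<comment> \<open>The constant is at least 1 because some projection fixes a nonzero vector.\<close>
  obtain m where "X m \<noteq> {0}" using nontriv by blast
  then obtain z where z: "z \<in> X m" "z \<noteq> 0" using subspace_0[OF subX[of m]] by blast
  then have "?G m z = z" by (intro GI) auto
  then have "\<gamma> \<le> C_a" using bound[of m z] z(2) by simp
  then show K: "C_a / \<gamma> \<ge> 1" using \<gamma> by simp
  show "norm (?G l x) \<le> C_a / \<gamma> * norm x"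
  proof (cases "?G l x = 0")
    case True
    have "0 \<le> C_a / \<gamma> * norm x" using K by (intro mult_nonneg_nonneg) auto
    then show ?thesis by (simp only: True norm_zero)
  next
    case False
    then show ?thesis using bound \<gamma> by (simp add: field_simps)
  qed
qed

section \<open>Quasi-orthogonality\<close>

lemma finite_window_const_le:
  assumes "\<And>u l. (\<Sum>k=l..<l+N. (norm (G (Suc k) u - G k u))\<^sup>2) \<le> C * (norm (u - G l u))\<^sup>2"
  shows "finite_window_const G N \<le> ennreal C"
  unfolding finite_window_const_def
  using assms by (intro SUP_least ennreal_leI) (simp add: pos_divide_le_eq)

lemma powr_smallo_of_nat:
  fixes s c :: real
  assumes "s < 1"
  shows "(\<lambda>N. c * real N powr s) \<in> o(\<lambda>N. real N)"
proof -
  have "(\<lambda>x::real. x powr s) \<in> o[at_top](\<lambda>x. x powr 1)"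
    using assms by (subst powr_smallo_iff) (auto intro: filterlim_ident)
  then have "(\<lambda>N. real N powr s) \<in> o(\<lambda>N. real N powr 1)"
    by (rule landau_o.small.compose) (rule filterlim_real_sequentially)
  then show ?thesis by (cases "c = 0") simp_all
qed

theorem theorem3p3:
  fixes a :: "'x::{real_inner, banach} \<Rightarrow> 'y::{real_inner, banach} \<Rightarrow> real"
    and X :: "nat \<Rightarrow> 'x set" and Y :: "nat \<Rightarrow> 'y set"
    and C_a \<gamma> K :: real
  assumes "bilinear a"
    and "\<And>x y. \<bar>a x y\<bar> \<le> C_a * norm x * norm y"
    and "well_posed_BN a"
    and "\<And>l. fin_dim_subspace (X l)" and "\<And>l. fin_dim_subspace (Y l)"
    and "\<And>l. X l \<subseteq> X (Suc l)" and "\<And>l. Y l \<subseteq> Y (Suc l)"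
    and "\<And>l. dim (X l) = dim (Y l)"
    and "\<not> (\<forall>l. X l = {0})"
    and "\<gamma> > 0" and "\<And>l. inf_sup_const a (X l) (Y l) \<ge> ennreal \<gamma>"
    and "K = C_a / \<gamma>"
  shows "sigma_K K < 1 \<and>
    (\<forall>u l N. N \<ge> 1 \<longrightarrow>
      (\<Sum>k=l..<l+N. (norm (galerkin a X Y (Suc k) u - galerkin a X Y k u))\<^sup>2)
        \<le> C_qo K * real N powr sigma_K K * (norm (u - galerkin a X Y l u))\<^sup>2) \<and>
    (\<forall>N\<ge>1. finite_window_const (galerkin a X Y) N \<le> ennreal (C_qo K * real N powr sigma_K K)) \<and>
    (\<lambda>N. C_qo K * real N powr sigma_K K) \<in> o(\<lambda>N. real N) \<and>
    (\<lambda>N. enn2real (finite_window_const (galerkin a X Y) N)) \<in> o(\<lambda>N. real N)"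
proof -
  let ?G = "galerkin a X Y"
  note G = galerkin_properties[OF assms(1,2,4-11)]
  have K: "K \<ge> 1" and bound: "\<And>l x. norm (?G l x) \<le> K * norm x"
    using G(4,5) assms(12) by auto
  have Gdiff: "?G l (x - y) = ?G l x - ?G l y" for l x y
    by (rule linear_diff[OF G(2)])
  have qo: "(\<Sum>k=l..<l+N. (norm (?G (Suc k) u - ?G k u))\<^sup>2)
      \<le> C_qo K * real N powr sigma_K K * (norm (u - ?G l u))\<^sup>2" if "N \<ge> 1" for u l N
  proof -
    \<comment> \<open>Freezing the family after the window keeps the span of \<open>u\<close> and the last space invariant.\<close>
    define P where "P k = ?G (min k (l + N))" for k
    define x where "x = u - ?G l u"
    obtain A where A: "finite A" "X (l + N) = span A"
      using assms(4) unfolding fin_dim_subspace_def by blast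
    have XA: "?G k z \<in> span (insert u A)" if "k \<le> l + N" for k z
    proof -
      have "?G k z \<in> X (l + N)"
        using lift_Suc_mono_le[of X, OF assms(6) that] G(1) by blast
      then show ?thesis using A(2) span_mono[of A "insert u A"] by auto
    qed
    have "(\<Sum>k=l..<l+N. (norm (P (Suc k) x - P k x))\<^sup>2)
        \<le> C_qo K * real N powr sigma_K K * (norm x)\<^sup>2"
    proof (rule sum_norm_increments_le[where B = "insert u A"])
      show "linear (P k)" for k by (simp add: P_def G(2))
      show "P j (P k z) = P (min j k) z" for j k z
        by (simp add: P_def G(3) min.assoc min.left_commute)
      show "norm (P k z) \<le> K * norm z" for k z by (simp add: P_def bound)
      show "P k z \<in> span (insert u A)" for k z by (simp add: P_def XA)
      show "x \<in> span (insert u A)"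
        unfolding x_def by (intro span_diff XA) (simp_all add: span_base)
    qed (use K A that in auto)
    moreover have "P (Suc k) x - P k x = ?G (Suc k) u - ?G k u" if "k \<in> {l..<l+N}" for k
      using that by (simp add: P_def x_def Gdiff G(3) min_absorb1 min_absorb2)
    ultimately show ?thesis by (simp add: x_def)
  qed
  have fw: "finite_window_const ?G N \<le> ennreal (C_qo K * real N powr sigma_K K)" if "N \<ge> 1" for N
    by (rule finite_window_const_le[OF qo[OF that]])
  have small: "(\<lambda>N. C_qo K * real N powr sigma_K K) \<in> o(\<lambda>N. real N)"
    by (rule powr_smallo_of_nat[OF sigma_K_bounds(2)[OF K]])
  have C0: "C_qo K \<ge> 0" using theta_K_bounds(2)[OF K] by (simp add: C_qo_def)
  have "enn2real (finite_window_const ?G N) \<le> C_qo K * real N powr sigma_K K" if "N \<ge> 1" for N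
    using fw[OF that] C0 by (intro enn2real_leI) simp_all
  then have "(\<lambda>N. enn2real (finite_window_const ?G N))
      \<in> O(\<lambda>N. C_qo K * real N powr sigma_K K)"
    using C0 by (intro bigoI[of _ 1] eventually_sequentiallyI[of 1]) (simp add: abs_mult)
  then have "(\<lambda>N. enn2real (finite_window_const ?G N)) \<in> o(\<lambda>N. real N)"
    using small by (rule landau_o.big_small_trans)
  then show ?thesis
    using sigma_K_bounds(2)[OF K] qo fw small by blast
qed

end
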